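(* Let $n,k$ be positive integers with $n\geq 2k^2+8k$, and let $\mathcal{F},\mathcal{G}\subset \binom{[n]}{k}$ be cross-intersecting. Then $$|\mathcal{F}\wedge \mathcal{G}|\leq \sum_{0\leq i\leq k-1}\binom{n-1}{i},$$ where equality holds if and only if $\mathcal{F}=\mathcal{G}=\mathcal{S}_{1}$ up to isomorphism.
   Context: $[n]=\{1,2,\ldots,n\}$ and $\binom{[n]}{k}$ is the collection of all $k$-element subsets of $[n]$. Families $\mathcal{F},\mathcal{G}\subset\binom{[n]}{k}$ are cross-intersecting if $F\cap G\neq\emptyset$ for all $F\in\mathcal{F}$, $G\in\mathcal{G}$. Define $\mathcal{F}\wedge\mathcal{G}=\{F\cap G\colon F\in\mathcal{F},\,G\in\mathcal{G}\}$ (here $F=G$ is allowed). $\mathcal{S}_1=\{S\in\binom{[n]}{k}\colon 1\in S\}$. "Up to isomorphism" means up to applying one permutation of $[n]$ to all the families involved. *)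

theory Defs
  imports Main "HOL-Library.Ramsey" "HOL-Combinatorics.Permutations"
begin

definition cross_intersecting :: "'a set set \<Rightarrow> 'a set set \<Rightarrow> bool" where
  "cross_intersecting \<F> \<G> \<longleftrightarrow> (\<forall>F\<in>\<F>. \<forall>G\<in>\<G>. F \<inter> G \<noteq> {})"

definition wedge :: "'a set set \<Rightarrow> 'a set set \<Rightarrow> 'a set set" where
  "wedge \<F> \<G> = {F \<inter> G | F G. F \<in> \<F> \<and> G \<in> \<G>}"

definition full_star :: "nat \<Rightarrow> nat \<Rightarrow> nat \<Rightarrow> nat set set" where
  "full_star n k x = {S \<in> nsets {1..n} k. x \<in> S}"

text \<open>Two pairs of families on \<open>[n] = {1..n}\<close> are isomorphic if one and the same permutation
  of \<open>[n]\<close> carries the first pair to the second, componentwise.\<close>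

definition isomorphic_pairs ::
  "nat \<Rightarrow> nat set set \<times> nat set set \<Rightarrow> nat set set \<times> nat set set \<Rightarrow> bool" where
  "isomorphic_pairs n P Q \<longleftrightarrow>
     (\<exists>\<pi>. \<pi> permutes {1..n} \<and> (\<lambda>S. \<pi> ` S) ` fst P = fst Q \<and> (\<lambda>S. \<pi> ` S) ` snd P = snd Q)"

end

theory Submission
  imports Defs Complex_Main
begin

text \<open>If all members of both families share an element \<open>x\<close>, every intersection is a set of size at most
\<open>k\<close> containing \<open>x\<close>, and there are exactly as many of these as the bound says
(\<open>card_bounded_sets_containing\<close>). Equality forces every \<open>k\<close>-element set through \<open>x\<close> to be an
intersection, hence a member of both families (\<open>stars_if_wedge_full\<close>).

Otherwise the inequality is strict. The intersections with at most \<open>k - 2\<close> elements can be counted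
trivially: there are barely more of them than in the extremal case. The \<open>k\<close>-element intersections
are the common members of the two families. The delicate part are those with \<open>k - 1\<close> elements, which
have no intersection property of their own, and whose trivial count is already too large.

Let \<open>T\<close> and \<open>S\<close> be minimum covers (transversals) of \<open>\<F>\<close> and \<open>\<G>\<close>, where \<open>card T \<le> card S = s\<close>. A member
of \<open>\<F>\<close> meets \<open>T\<close>, and no set with fewer than \<open>s\<close> elements covers \<open>\<G>\<close>. Choosing an element of \<open>T\<close> and
then \<open>s - 1\<close> times an element of a member of \<open>\<G>\<close> that is still missed bounds \<open>card \<F>\<close>, hence the number
of \<open>k\<close>-element intersections (\<open>card_wedge_level_top_le\<close>). Each of the later choices has \<open>k\<close> options and
fixes one element, so it multiplies the bound by about \<open>k\<^sup>2 / n < 1 / 2\<close>. For \<open>s = 1\<close> the two covers are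
distinct singletons, and all common members contain both points.

Let \<open>A = F \<inter> G\<close> have \<open>k - 1\<close> elements, so that \<open>F = insert x A\<close> and \<open>G = insert y A\<close>. Either \<open>A\<close> meets
\<open>T \<union> S\<close>, and thus lies in one of at most \<open>2 * s\<close> stars, or \<open>x \<in> T\<close> and \<open>y \<in> S\<close>. For fixed \<open>x \<noteq> y\<close> the sets \<open>A\<close>
of the latter kind are pairwise intersecting (\<open>split_traces_intersecting\<close>), and they cover all
members of \<open>\<G>\<close> that avoid \<open>x\<close>; so branching applies to them too (\<open>card_split_traces_le\<close>).

In multiples of \<open>D = (n - 1) choose (k - 2)\<close>, with \<open>q = (k - 1) / (2 * k + 8)\<close> and \<open>s \<ge> 2\<close>, the
levels \<open>k\<close> and \<open>k - 1\<close> contribute at most \<open>s * k * q ^ (s - 2)\<close> and \<open>2 * s + s\<^sup>2 * (s - 1) * q ^ (s - 2)\<close>,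
and the excess of the smaller levels is at most 1. The sum is at most \<open>2 * k + 9\<close>
(\<open>cover_number_inequality\<close>), whereas \<open>(n - 1) choose (k - 1)\<close>, the top term of the
bound, is larger than \<open>(2 * k + 9) * D\<close>.\<close>

section \<open>Counting by branching\<close>

lemma card_nsets_containing_le:
  assumes "finite V" "finite P"
  shows "card {A \<in> nsets V m. P \<subseteq> A} \<le> (card V - card P) choose (m - card P)"
proof (cases "P \<subseteq> V")
  case True
  have "(\<lambda>A. A - P) ` {A \<in> nsets V m. P \<subseteq> A} \<subseteq> nsets (V - P) (m - card P)"
    using assms(2) by (auto simp: nsets_def card_Diff_subset)
  moreover have "inj_on (\<lambda>A. A - P) {A \<in> nsets V m. P \<subseteq> A}"
    by (rule inj_onI) blast
  ultimately have "card {A \<in> nsets V m. P \<subseteq> A} \<le> card (nsets (V - P) (m - card P))"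
    using assms(1) by (meson card_inj_on_le finite_Diff finite_imp_finite_nsets)
  then show ?thesis
    using True assms by (simp add: card_Diff_subset)
next
  case False
  then have "{A \<in> nsets V m. P \<subseteq> A} = {}"
    by (auto simp: nsets_def)
  then show ?thesis by (metis card.empty zero_le)
qed

text \<open>The sets of \<open>X\<close> containing \<open>P\<close> are counted by growing \<open>P\<close> one element at a time: as long as \<open>P\<close>
  has fewer than \<open>d\<close> elements, some set \<open>E\<close> of size at most \<open>k\<close> that all of \<open>X\<close> must meet is still
  missed by \<open>P\<close>. After \<open>j\<close> steps the set has \<open>d\<close> elements, and only its supersets remain.\<close>

lemma branching_containing:
  assumes "finite V" and X: "X \<subseteq> nsets V m"
    and E: "\<And>P. finite P \<Longrightarrow> card P < d \<Longrightarrow>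
      \<exists>E. finite E \<and> card E \<le> k \<and> P \<inter> E = {} \<and> (\<forall>A\<in>X. A \<inter> E \<noteq> {})"
    and "finite P" "card P + j = d"
  shows "card {A \<in> X. P \<subseteq> A} \<le> k ^ j * ((card V - d) choose (m - d))"
  using assms(4,5)
proof (induction j arbitrary: P)
  case 0
  have "card {A \<in> X. P \<subseteq> A} \<le> card {A \<in> nsets V m. P \<subseteq> A}"
    using X \<open>finite V\<close> by (intro card_mono) (auto simp: finite_imp_finite_nsets)
  also have "\<dots> \<le> (card V - d) choose (m - d)"
    using card_nsets_containing_le[OF \<open>finite V\<close> 0(1)] 0(2) by simp
  finally show ?case by simp
next
  case (Suc j)
  let ?b = "(card V - d) choose (m - d)"
  \<comment> \<open>Every member of \<open>X\<close> meets \<open>E\<close>, so \<open>P\<close> can be enlarged in at most \<open>k\<close> ways, each by a new element.\<close>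
  from Suc.prems obtain E where E: "finite E" "card E \<le> k" "P \<inter> E = {}" "\<forall>A\<in>X. A \<inter> E \<noteq> {}"
    using assms(3)[of P] by auto
  have finX: "finite X"
    using finite_subset[OF X] finite_imp_finite_nsets[OF \<open>finite V\<close>] by simp
  have "{A \<in> X. P \<subseteq> A} \<subseteq> (\<Union>e\<in>E. {A \<in> X. insert e P \<subseteq> A})"
  proof
    fix A assume A: "A \<in> {A \<in> X. P \<subseteq> A}"
    with E(4) obtain e where "e \<in> A" "e \<in> E" by auto
    with A show "A \<in> (\<Union>e\<in>E. {A \<in> X. insert e P \<subseteq> A})" by auto
  qed
  then have "card {A \<in> X. P \<subseteq> A} \<le> card (\<Union>e\<in>E. {A \<in> X. insert e P \<subseteq> A})"
    using finX E(1) by (intro card_mono) auto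
  also have "\<dots> \<le> (\<Sum>e\<in>E. card {A \<in> X. insert e P \<subseteq> A})"
    by (rule card_UN_le[OF E(1)])
  also have "\<dots> \<le> (\<Sum>e\<in>E. k ^ j * ?b)"
  proof (rule sum_mono)
    fix e assume "e \<in> E"
    then have "e \<notin> P" using E(3) by blast
    then show "card {A \<in> X. insert e P \<subseteq> A} \<le> k ^ j * ?b"
      using Suc.prems by (intro Suc.IH) auto
  qed
  also have "\<dots> \<le> k ^ Suc j * ?b"
    using E(2) by simp
  finally show ?case .
qed

text \<open>The first step branches over \<open>T\<close>, which costs \<open>card T\<close> instead of \<open>k\<close>. With a minimum cover for
  \<open>T\<close> this saving is decisive, since \<open>n\<close> is only of order \<open>2 * k\<^sup>2\<close>.\<close>

lemma branching:
  assumes "finite V" and X: "X \<subseteq> nsets V m" and "d \<ge> 1"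
    and T: "finite T" "\<And>A. A \<in> X \<Longrightarrow> A \<inter> T \<noteq> {}"
    and E: "\<And>P. finite P \<Longrightarrow> card P < d \<Longrightarrow>
      \<exists>E. finite E \<and> card E \<le> k \<and> P \<inter> E = {} \<and> (\<forall>A\<in>X. A \<inter> E \<noteq> {})"
  shows "card X \<le> card T * (k ^ (d - 1) * ((card V - d) choose (m - d)))"
proof -
  have finX: "finite X"
    using finite_subset[OF X] finite_imp_finite_nsets[OF \<open>finite V\<close>] by simp
  have "X \<subseteq> (\<Union>a\<in>T. {A \<in> X. {a} \<subseteq> A})"
    using T(2) by blast
  then have "card X \<le> card (\<Union>a\<in>T. {A \<in> X. {a} \<subseteq> A})"
    using finX T(1) by (intro card_mono) auto
  also have "\<dots> \<le> (\<Sum>a\<in>T. card {A \<in> X. {a} \<subseteq> A})"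
    by (rule card_UN_le[OF T(1)])
  also have "\<dots> \<le> (\<Sum>a\<in>T. k ^ (d - 1) * ((card V - d) choose (m - d)))"
    using \<open>d \<ge> 1\<close> by (intro sum_mono branching_containing[OF \<open>finite V\<close> X E]) auto
  finally show ?thesis by simp
qed

section \<open>Estimates for binomial coefficients\<close>

text \<open>Each branching step multiplies the count by \<open>k\<close> and fixes one more element, which divides the
  binomial coefficient by at least \<open>N / M\<close>. The factor \<open>q\<close> bounds the net effect.\<close>

lemma power_times_binomial_le:
  fixes q :: real
  assumes "0 \<le> q" "q \<le> real k" "real k * real M \<le> q * real N" "M \<le> N" "j \<le> M"
  shows "real (k ^ j * ((N - j) choose (M - j))) \<le> q ^ j * real (N choose M)"
  using assms(3-5)
proof (induction j arbitrary: N M)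
  case (Suc j)
  then obtain M' N' where MN: "M = Suc M'" "N = Suc N'"
    by (cases M; cases N) auto
  have "real k * real M' \<le> q * real N'"
    using Suc.prems(1) assms(2) by (simp add: MN algebra_simps)
  then have IH: "real (k ^ j * ((N' - j) choose (M' - j))) \<le> q ^ j * real (N' choose M')"
    using Suc.prems by (intro Suc.IH) (auto simp: MN)
  \<comment> \<open>Absorption turns the quotient of the two binomials into \<open>M / N\<close>, and \<open>k * M / N \<le> q\<close>.\<close>
  have "real N * real (N' choose M') = real M * real (N choose M)"
    using Suc_times_binomial_eq[of N' M'] unfolding MN
    by (simp only: of_nat_mult[symmetric] mult.commute)
  then have "real N * (real k * real (N' choose M')) = (real k * real M) * real (N choose M)"
    by (simp add: algebra_simps)
  also have "\<dots> \<le> (q * real N) * real (N choose M)"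
    using Suc.prems(1) by (intro mult_right_mono) auto
  finally have "real N * (real k * real (N' choose M')) \<le> real N * (q * real (N choose M))"
    by (simp add: algebra_simps)
  then have step: "real k * real (N' choose M') \<le> q * real (N choose M)"
    using MN by (simp add: mult_le_cancel_left_pos)
  have "real (k ^ Suc j * ((N - Suc j) choose (M - Suc j)))
      = real k * real (k ^ j * ((N' - j) choose (M' - j)))"
    by (simp add: MN)
  also have "\<dots> \<le> real k * (q ^ j * real (N' choose M'))"
    using IH by (intro mult_left_mono) auto
  also have "\<dots> = q ^ j * (real k * real (N' choose M'))"
    by simp
  also have "\<dots> \<le> q ^ j * (q * real (N choose M))"
    using step assms(1) by (intro mult_left_mono) auto
  finally show ?case by (simp add: algebra_simps)
qed simp

text \<open>Branching to depth \<open>d\<close> from a set of \<open>d\<close> elements gives the bound \<open>d * q ^ (d - 1)\<close>. The true depth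
  is often unknown; by monotonicity a lower bound on it suffices.\<close>

lemma index_times_power_decreasing:
  fixes q :: real
  assumes "0 \<le> q" "q \<le> 1 / 2" "1 \<le> i" "i \<le> j"
  shows "real j * q ^ (j - 1) \<le> real i * q ^ (i - 1)"
  using \<open>i \<le> j\<close>
proof (induction j rule: dec_induct)
  case (step j)
  then obtain l where l: "j = Suc l" using \<open>1 \<le> i\<close> by (cases j) auto
  have "real (Suc j) * q \<le> real (Suc j) * (1 / 2)"
    using assms(2) by (intro mult_left_mono) auto
  also have "\<dots> \<le> real j"
    by (simp add: l)
  finally have "(real (Suc j) * q) * q ^ l \<le> real j * q ^ l"
    using assms(1) by (intro mult_right_mono) auto
  then show ?case
    using step.IH by (simp add: l algebra_simps)
qed simp

text \<open>In this range consecutive binomial coefficients at least double.\<close>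

lemma sum_binomial_below_le:
  assumes "3 * m \<le> N + 1"
  shows "(\<Sum>i<m. N choose i) \<le> N choose m"
  using assms
proof (induction m)
  case (Suc m)
  have "Suc m * (N choose Suc m) = (N - m) * (N choose m)"
    by (simp only: binomial_absorption binomial_absorb_comp)
  moreover have "2 * Suc m * (N choose m) \<le> (N - m) * (N choose m)"
    using Suc.prems by (intro mult_right_mono) auto
  ultimately have "Suc m * (2 * (N choose m)) \<le> Suc m * (N choose Suc m)"
    by (simp add: algebra_simps)
  then have "2 * (N choose m) \<le> N choose Suc m"
    by (simp only: mult_le_cancel1)
  then show ?case using Suc by simp
qed simp

lemma sum_binomial_Suc:
  "(\<Sum>i\<le>m. Suc N choose i) = (\<Sum>i\<le>m. N choose i) + (\<Sum>i<m. N choose i)"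
  by (induction m) (simp_all add: lessThan_Suc_atMost[symmetric])

text \<open>For two families with minimum covers of size at most \<open>s\<close>, the left-hand side bounds (in multiples of
  a binomial coefficient) the part of the two upper levels of the wedge that depends on branching:
  \<open>s\<^sup>2\<close> pairs of added elements, each with \<open>(s - 1) * q ^ (s - 2)\<close> traces, and \<open>s * k * q ^ (s - 2)\<close>
  full sets. The right-hand side is what the hypothesis on \<open>n\<close> leaves for them after \<open>2 * s\<close> has been
  spent on the sets meeting a minimum cover and 1 on the smaller levels. Equality holds at \<open>s = 2\<close>,
  the case that dictates the linear term of the hypothesis.\<close>

lemma cover_number_inequality:
  fixes s k :: nat and q :: real
  defines "q \<equiv> (real k - 1) / (2 * real k + 8)"
  assumes "2 \<le> s" "s \<le> k"
  shows "real s * q ^ (s - 2) * (real s * (real s - 1) + real k) \<le> 2 * (real k - real s) + 8"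
proof -
  have q0: "0 \<le> q" and q2: "q \<le> 1 / 2"
    using assms(2,3) by (auto simp: q_def divide_simps)
  have by_upper_bound: ?thesis
    if "q \<le> c" "real s * c ^ (s - 2) * (real s * (real s - 1) + real k) \<le> 2 * (real k - real s) + 8" for c
  proof -
    have "q ^ (s - 2) \<le> c ^ (s - 2)"
      using q0 that(1) by (rule power_mono[rotated])
    then have "real s * q ^ (s - 2) * (real s * (real s - 1) + real k)
        \<le> real s * c ^ (s - 2) * (real s * (real s - 1) + real k)"
      using \<open>2 \<le> s\<close> by (intro mult_right_mono mult_left_mono) auto
    then show ?thesis using that(2) by linarith
  qed
  consider "s = 2" | "s = 3" | "s = 4" | "s \<in> {5, 6, 7}" | "s \<ge> 8"
    using \<open>2 \<le> s\<close> by force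
  then show ?thesis
  proof cases
    case 1
    then show ?thesis by simp
  next
    case 2
    have "3 * (real k - 1) * (6 + real k) \<le> (2 * real k + 2) * (2 * real k + 8)"
      using zero_le_power2[of "real k"] by (simp add: algebra_simps power2_eq_square)
    then show ?thesis using 2 by (simp add: q_def field_simps)
  next
    case 3
    have "k \<ge> 4" using 3 assms by simp
    then obtain j where j: "k = j + 4" by (metis le_add_diff_inverse2)
    have "4 * (real k - 1)^2 * (12 + real k) \<le> (2 * real k) * (2 * real k + 8)^2"
      by (simp add: j algebra_simps power2_eq_square)
    then have "4 * q\<^sup>2 * (12 + real k) \<le> 2 * real k"
      using \<open>k \<ge> 4\<close> by (simp add: q_def power_divide divide_simps)
    then show ?thesis using 3 by simp
  next
    \<comment> \<open>The bound \<open>13 / 36\<close> is the value of \<open>q\<close> at \<open>k = 14\<close>; for larger \<open>k\<close> the right-hand side is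
      large enough for the limit value \<open>1 / 2\<close>.\<close>
    case 4
    show ?thesis
    proof (cases "k \<le> 14")
      case True
      then have "q \<le> 13 / 36"
        by (simp add: q_def divide_simps)
      then show ?thesis
        using 4 \<open>s \<le> k\<close> by (intro by_upper_bound[of "13 / 36"]) (auto simp: power_numeral_reduce)
    next
      case False
      then show ?thesis
        using 4 q2 by (intro by_upper_bound[of "1 / 2"]) (auto simp: power_numeral_reduce)
    qed
  next
    \<comment> \<open>Write \<open>s * (s - 1) + k\<close> as \<open>s\<^sup>2 + (k - s)\<close>: after multiplication by
      \<open>s * q ^ (s - 2)\<close> the square contributes at most 8, and the factor of \<open>k - s\<close> is at most 2.\<close>
    case 5
    have cube: "s ^ 3 \<le> 2 ^ (s + 1)"
      using 5
    proof (induction s rule: dec_induct)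
      case (step m)
      have "3 * m * m + 3 * m + 1 \<le> m ^ 3"
      proof -
        have "3 * m + 1 \<le> m * m" using mult_right_mono[OF step(1), of m] step(1) by linarith
        moreover have "8 * (m * m) \<le> m ^ 3"
          using mult_right_mono[OF step(1), of "m * m"] by (simp add: power3_eq_cube algebra_simps)
        ultimately show ?thesis by (simp add: algebra_simps)
      qed
      then have "Suc m ^ 3 \<le> 2 * m ^ 3"
        by (simp add: power3_eq_cube algebra_simps)
      then show ?case using step.IH by simp
    qed simp
    obtain l where l: "s = l + 2" using \<open>2 \<le> s\<close> by (metis le_add_diff_inverse2)
    have "real (s ^ 3) \<le> real (2 ^ (s + 1))"
      using cube by (simp only: of_nat_le_iff)
    then have c: "real s ^ 3 * (1 / 2) ^ (s - 2) \<le> 8"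
      by (simp add: l field_simps)
    have "real s * (1 / 2) ^ (s - 2) * 64 \<le> real s * (1 / 2) ^ (s - 2) * (real s * real s)"
      using mult_mono[of 8 "real s" 8 "real s"] 5 by (intro mult_left_mono) auto
    also have "\<dots> = real s ^ 3 * (1 / 2) ^ (s - 2)"
      by (simp add: power3_eq_cube)
    finally have "real s * (1 / 2) ^ (s - 2) \<le> 2" using c by linarith
    then have "real s * (1 / 2) ^ (s - 2) * (real k - real s) \<le> 2 * (real k - real s)"
      using \<open>s \<le> k\<close> by (intro mult_right_mono) auto
    then have "real s * (1 / 2) ^ (s - 2) * (real s * (real s - 1) + real k) \<le> 2 * (real k - real s) + 8"
      using c by (simp add: algebra_simps power3_eq_cube)
    then show ?thesis using q2 by (rule by_upper_bound[rotated])
  qed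
qed

section \<open>Minimum covers of cross-intersecting families\<close>

text \<open>Finiteness is part of the notion because sizes of covers are compared by \<open>card\<close>, which is 0 on
  infinite sets.\<close>

definition covers :: "'a set \<Rightarrow> 'a set set \<Rightarrow> bool" where
  "covers T \<F> \<longleftrightarrow> finite T \<and> (\<forall>E\<in>\<F>. T \<inter> E \<noteq> {})"

definition minimum_cover :: "'a set \<Rightarrow> 'a set set \<Rightarrow> bool" where
  "minimum_cover T \<F> \<longleftrightarrow> covers T \<F> \<and> (\<forall>P. covers P \<F> \<longrightarrow> card T \<le> card P)"

lemma minimum_cover_exists:
  assumes "covers C \<F>"
  shows "\<exists>T. minimum_cover T \<F>"
  using ex_has_least_nat[of "\<lambda>T. covers T \<F>" C card, OF assms]
  by (auto simp: minimum_cover_def)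

lemma minimum_coverD:
  assumes "minimum_cover T \<F>"
  shows "finite T" "\<And>E. E \<in> \<F> \<Longrightarrow> E \<inter> T \<noteq> {}"
  using assms by (simp_all add: minimum_cover_def covers_def Int_commute)

lemma disjoint_member_if_small:
  assumes "minimum_cover T \<F>" "finite P" "card P < card T"
  obtains E where "E \<in> \<F>" "P \<inter> E = {}"
proof -
  have "\<not> covers P \<F>"
    using assms by (auto simp: minimum_cover_def not_le[symmetric])
  then show ?thesis using assms(2) that by (auto simp: covers_def)
qed

lemma cross_member_covers:
  assumes "cross_intersecting \<F> \<G>" "\<F> \<subseteq> nsets V k" "F \<in> \<F>"
  shows "covers F \<G>" "card F = k"
  using assms by (auto simp: cross_intersecting_def covers_def nsets_def)

lemma cross_intersectingD:
  "cross_intersecting \<F> \<G> \<Longrightarrow> F \<in> \<F> \<Longrightarrow> G \<in> \<G> \<Longrightarrow> F \<inter> G \<noteq> {}"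
  by (simp add: cross_intersecting_def)

lemma cross_intersecting_sym:
  assumes "cross_intersecting \<F> \<G>"
  shows "cross_intersecting \<G> \<F>"
  unfolding cross_intersecting_def
proof (intro ballI)
  fix G F assume "G \<in> \<G>" "F \<in> \<F>"
  then have "F \<inter> G \<noteq> {}" using assms by (simp add: cross_intersecting_def)
  then show "G \<inter> F \<noteq> {}" by (simp add: Int_commute)
qed

lemma wedge_commute: "wedge \<F> \<G> = wedge \<G> \<F>"
proof -
  have "wedge \<A> \<B> \<subseteq> wedge \<B> \<A>" for \<A> \<B> :: "'a set set"
  proof
    fix A assume "A \<in> wedge \<A> \<B>"
    then obtain F G where "F \<in> \<A>" "G \<in> \<B>" "A = G \<inter> F"
      unfolding wedge_def by (auto simp: Int_commute)
    then show "A \<in> wedge \<B> \<A>" unfolding wedge_def by auto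
  qed
  then show ?thesis by (intro equalityI)
qed

lemma wedge_memberD:
  assumes "\<F> \<subseteq> nsets V k" "A \<in> wedge \<F> \<G>"
  shows "A \<subseteq> V" "finite A" "card A \<le> k"
proof -
  obtain F where "F \<in> \<F>" and A: "A \<subseteq> F"
    using assms(2) by (auto simp: wedge_def)
  then have F: "F \<subseteq> V" "finite F" "card F = k"
    using assms(1) by (auto simp: nsets_def)
  show "A \<subseteq> V" "finite A" using A F finite_subset by auto
  show "card A \<le> k" using card_mono[OF F(2) A] F(3) by simp
qed

text \<open>Members of \<open>\<F>\<close> meet \<open>T\<close>, and they cover \<open>\<G>\<close>, so a set smaller than \<open>S\<close> can be branched over a
  member of \<open>\<G>\<close> that it misses.\<close>

lemma card_family_le_branching:
  assumes "finite V" and \<F>: "\<F> \<subseteq> nsets V k" and \<G>: "\<G> \<subseteq> nsets V k"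
    and cross: "cross_intersecting \<F> \<G>"
    and T: "minimum_cover T \<F>" and S: "minimum_cover S \<G>" and "card S \<ge> 1"
  shows "card \<F> \<le> card T * (k ^ (card S - 1) * ((card V - card S) choose (k - card S)))"
proof (rule branching[OF \<open>finite V\<close> \<F> \<open>card S \<ge> 1\<close> minimum_coverD[OF T]])
  fix P :: "'a set" assume "finite P" "card P < card S"
  then obtain E where E: "E \<in> \<G>" "P \<inter> E = {}"
    using disjoint_member_if_small[OF S] by metis
  then have "finite E \<and> card E \<le> k \<and> P \<inter> E = {} \<and> (\<forall>A\<in>\<F>. A \<inter> E \<noteq> {})"
    using \<G> cross by (auto simp: nsets_def cross_intersecting_def)
  then show "\<exists>E. finite E \<and> card E \<le> k \<and> P \<inter> E = {} \<and> (\<forall>A\<in>\<F>. A \<inter> E \<noteq> {})" ..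
qed

section \<open>Intersections of full size\<close>

text \<open>A \<open>k\<close>-element intersection of two \<open>k\<close>-element sets is equal to both.\<close>

lemma wedge_level_top:
  assumes "\<F> \<subseteq> nsets V k" "\<G> \<subseteq> nsets V k"
  shows "{A \<in> wedge \<F> \<G>. card A = k} \<subseteq> \<F> \<inter> \<G>"
proof
  fix A assume "A \<in> {A \<in> wedge \<F> \<G>. card A = k}"
  then obtain F G where FG: "F \<in> \<F>" "G \<in> \<G>" "A = F \<inter> G" "card A = k"
    by (auto simp: wedge_def)
  have "finite F" "card F = k" "finite G" "card G = k"
    using FG assms by (auto simp: nsets_def)
  then have "A = F" "A = G"
    using FG(3,4) card_subset_eq[of F A] card_subset_eq[of G A] by auto
  then show "A \<in> \<F> \<inter> \<G>" using FG by auto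
qed

lemma card_wedge_level_top_le:
  fixes q :: real
  assumes "finite V" and \<F>: "\<F> \<subseteq> nsets V k" and \<G>: "\<G> \<subseteq> nsets V k"
    and cross: "cross_intersecting \<F> \<G>"
    and T: "minimum_cover T \<F>" and S: "minimum_cover S \<G>"
    and "2 \<le> card S" "card S \<le> k" "k \<le> card V"
    and q: "0 \<le> q" "q \<le> 1 / 2" "real k * real (k - 2) \<le> q * real (card V - 2)"
  shows "real (card {A \<in> wedge \<F> \<G>. card A = k}) \<le>
    real (card T) * real k * q ^ (card S - 2) * real ((card V - 1) choose (k - 2))"
proof -
  define s where "s = card S"
  have s: "2 \<le> s" "s \<le> k" using assms by (auto simp: s_def)
  have "q \<le> real k" using q(2) s by linarith
  have fin\<F>: "finite \<F>"
    using finite_subset[OF \<F>] finite_imp_finite_nsets[OF \<open>finite V\<close>] by simp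
  have eq: "card V - 2 - (s - 2) = card V - s" "k - 2 - (s - 2) = k - s" "s - 1 = Suc (s - 2)"
    using s by auto
  have "card {A \<in> wedge \<F> \<G>. card A = k} \<le> card \<F>"
    using wedge_level_top[OF \<F> \<G>] fin\<F> by (intro card_mono) auto
  also have "\<dots> \<le> card T * (k ^ (s - 1) * ((card V - s) choose (k - s)))"
    using card_family_le_branching[OF \<open>finite V\<close> \<F> \<G> cross T S] s by (simp add: s_def)
  also have "\<dots> = card T * k * (k ^ (s - 2) * ((card V - 2 - (s - 2)) choose (k - 2 - (s - 2))))"
    unfolding eq by simp
  finally have "real (card {A \<in> wedge \<F> \<G>. card A = k}) \<le>
      real (card T) * real k * real (k ^ (s - 2) * ((card V - 2 - (s - 2)) choose (k - 2 - (s - 2))))"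
    by (simp only: of_nat_mult[symmetric] of_nat_le_iff)
  also have "\<dots> \<le> real (card T) * real k * (q ^ (s - 2) * real ((card V - 2) choose (k - 2)))"
    using q(1) s \<open>k \<le> card V\<close> \<open>q \<le> real k\<close>
    by (intro mult_left_mono power_times_binomial_le[OF _ _ q(3)]) auto
  also have "\<dots> \<le> real (card T) * real k * (q ^ (s - 2) * real ((card V - 1) choose (k - 2)))"
    using q(1) by (intro mult_left_mono) (auto intro: binomial_right_mono)
  finally show ?thesis by (simp add: s_def mult.assoc)
qed

text \<open>This replaces the branching bound when both covers are singletons, where branching over a single
  element gains nothing.\<close>

lemma card_wedge_level_top_le_common_elements:
  assumes "finite V" and \<F>: "\<F> \<subseteq> nsets V k" and \<G>: "\<G> \<subseteq> nsets V k"
    and "a \<noteq> b" "\<And>F. F \<in> \<F> \<Longrightarrow> a \<in> F" "\<And>G. G \<in> \<G> \<Longrightarrow> b \<in> G"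
  shows "card {A \<in> wedge \<F> \<G>. card A = k} \<le> (card V - 1) choose (k - 2)"
proof -
  have "{A \<in> wedge \<F> \<G>. card A = k} \<subseteq> {A \<in> nsets V k. {a, b} \<subseteq> A}"
    using wedge_level_top[OF \<F> \<G>] \<F> assms(5,6) by blast
  then have "card {A \<in> wedge \<F> \<G>. card A = k} \<le> card {A \<in> nsets V k. {a, b} \<subseteq> A}"
    using \<open>finite V\<close> by (intro card_mono) (auto simp: finite_imp_finite_nsets)
  also have "\<dots> \<le> (card V - 2) choose (k - 2)"
    using card_nsets_containing_le[OF \<open>finite V\<close>, of "{a, b}" k] \<open>a \<noteq> b\<close> by (simp add: numeral_2_eq_2)
  also have "\<dots> \<le> (card V - 1) choose (k - 2)"
    by (rule binomial_right_mono) simp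
  finally show ?thesis .
qed

section \<open>Intersections with one element less\<close>

text \<open>These are the \<open>(k - 1)\<close>-element members of the wedge that arise from two sets with the prescribed
  private elements \<open>x\<close> and \<open>y\<close>.\<close>

definition split_traces :: "'a set set \<Rightarrow> 'a set set \<Rightarrow> 'a \<Rightarrow> 'a \<Rightarrow> 'a set set" where
  "split_traces \<F> \<G> x y = {A. x \<notin> A \<and> y \<notin> A \<and> insert x A \<in> \<F> \<and> insert y A \<in> \<G>}"

lemma split_traces_nsets:
  assumes "\<F> \<subseteq> nsets V k"
  shows "split_traces \<F> \<G> x y \<subseteq> nsets V (k - 1)"
proof
  fix A assume A: "A \<in> split_traces \<F> \<G> x y"
  then have "insert x A \<in> nsets V k" "x \<notin> A"
    using assms by (auto simp: split_traces_def)
  then show "A \<in> nsets V (k - 1)"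
    by (auto simp: nsets_def)
qed

text \<open>In the intersection of \<open>insert x A\<close> and \<open>insert y B\<close>, neither \<open>x\<close> nor \<open>y\<close> can occur, so the common
  element lies in both traces. This is the key to the level \<open>k - 1\<close>: traces inherit an intersection
  property although the wedge as a whole has none.\<close>

lemma split_traces_intersecting:
  assumes "cross_intersecting \<F> \<G>" "x \<noteq> y" "A \<in> split_traces \<F> \<G> x y" "B \<in> split_traces \<F> \<G> x y"
  shows "A \<inter> B \<noteq> {}"
proof -
  have "insert x A \<inter> insert y B \<noteq> {}"
    using assms(3,4) by (intro cross_intersectingD[OF assms(1)]) (auto simp: split_traces_def)
  then show ?thesis
    using assms(2-4) by (auto simp: split_traces_def)
qed

text \<open>Since the traces are intersecting, a minimum cover \<open>R\<close> of them can serve as the first branching set,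
  and the depth is the larger of \<open>card R\<close> and \<open>card S - 1\<close>. Thus the first factor never exceeds the
  depth.\<close>

lemma card_split_traces_branching:
  assumes "finite V" and \<F>: "\<F> \<subseteq> nsets V k" and \<G>: "\<G> \<subseteq> nsets V k"
    and cross: "cross_intersecting \<F> \<G>" and S: "minimum_cover S \<G>"
    and "x \<noteq> y" and nonempty: "split_traces \<F> \<G> x y \<noteq> {}"
  obtains d where "1 \<le> d" "card S - 1 \<le> d" "d \<le> k - 1"
    "card (split_traces \<F> \<G> x y) \<le> d * (k ^ (d - 1) * ((card V - d) choose (k - 1 - d)))"
proof -
  define X where "X = split_traces \<F> \<G> x y"
  have X: "X \<subseteq> nsets V (k - 1)"
    using split_traces_nsets[OF \<F>] by (simp add: X_def)
  have inter: "A \<inter> B \<noteq> {}" if "A \<in> X" "B \<in> X" for A B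
    using split_traces_intersecting[OF cross \<open>x \<noteq> y\<close>] that by (simp add: X_def)
  obtain A0 where A0: "A0 \<in> X" using nonempty by (auto simp: X_def)
  then have A0': "covers A0 X" "card A0 = k - 1" "finite A0"
    using inter X by (auto simp: covers_def nsets_def)
  then obtain R where R: "minimum_cover R X" using minimum_cover_exists by blast
  then have "card R \<le> k - 1" using A0' by (auto simp: minimum_cover_def)
  moreover have "card R \<ge> 1"
    using minimum_coverD[OF R] A0 by (auto simp: Suc_le_eq card_gt_0_iff)
  moreover have "card S - 1 \<le> k - 1"
  proof -
    have "insert x A0 \<in> \<F>" using A0 by (simp add: X_def split_traces_def)
    then have "covers (insert x A0) \<G>" "card (insert x A0) = k"
      using cross_member_covers[OF cross \<F>] by auto
    then show ?thesis using S by (auto simp: minimum_cover_def)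
  qed
  moreover define d where "d = max (card R) (card S - 1)"
  ultimately have d: "1 \<le> d" "card S - 1 \<le> d" "d \<le> k - 1" by auto
  \<comment> \<open>A set smaller than \<open>R\<close> is missed by some trace, which all the other traces meet; a set with
    fewer than \<open>card S - 1\<close> elements still fails to cover \<open>\<G>\<close> after \<open>x\<close> is added to it.\<close>
  have "card X \<le> card R * (k ^ (d - 1) * ((card V - d) choose (k - 1 - d)))"
  proof (rule branching[OF \<open>finite V\<close> X \<open>1 \<le> d\<close> minimum_coverD[OF R]])
    fix P :: "'a set" assume P: "finite P" "card P < d"
    then consider "card P < card R" | "card P < card S - 1"
      unfolding d_def by linarith
    then show "\<exists>E. finite E \<and> card E \<le> k \<and> P \<inter> E = {} \<and> (\<forall>A\<in>X. A \<inter> E \<noteq> {})"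
    proof cases
      case 1
      then obtain E where E: "E \<in> X" "P \<inter> E = {}"
        using disjoint_member_if_small[OF R \<open>finite P\<close>] by metis
      moreover have "finite E" "card E \<le> k"
        using X E(1) by (auto simp: nsets_def)
      ultimately show ?thesis using inter by blast
    next
      case 2
      have "card (insert x P) \<le> Suc (card P)" by (rule card_insert_le_m1) auto
      then have "card (insert x P) < card S" using 2 by linarith
      then obtain E where E: "E \<in> \<G>" "insert x P \<inter> E = {}"
        using disjoint_member_if_small[OF S, of "insert x P"] \<open>finite P\<close> by auto
      have "A \<inter> E \<noteq> {}" if "A \<in> X" for A
      proof -
        have "insert x A \<inter> E \<noteq> {}"
          using that E(1) by (intro cross_intersectingD[OF cross]) (auto simp: X_def split_traces_def)
        then show ?thesis using E(2) by auto
      qed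
      moreover have "finite E" "card E \<le> k"
        using \<G> E(1) by (auto simp: nsets_def)
      ultimately show ?thesis using E(2) by blast
    qed
  qed
  also have "\<dots> \<le> d * (k ^ (d - 1) * ((card V - d) choose (k - 1 - d)))"
    by (intro mult_right_mono) (auto simp: d_def)
  finally show ?thesis using d that unfolding X_def by blast
qed

text \<open>The unknown depth is replaced by any smaller \<open>i\<close>. For \<open>i = 1\<close> this is the bound of an intersecting
  family by a star.\<close>

lemma card_split_traces_le:
  fixes q :: real
  assumes "finite V" and \<F>: "\<F> \<subseteq> nsets V k" and \<G>: "\<G> \<subseteq> nsets V k"
    and cross: "cross_intersecting \<F> \<G>" and S: "minimum_cover S \<G>" and "x \<noteq> y"
    and q: "0 \<le> q" "q \<le> 1 / 2" "real k * real (k - 2) \<le> q * real (card V - 1)"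
    and "k \<le> card V" and i: "1 \<le> i" "i \<le> max 1 (card S - 1)"
  shows "real (card (split_traces \<F> \<G> x y)) \<le> real i * q ^ (i - 1) * real ((card V - 1) choose (k - 2))"
proof (cases "split_traces \<F> \<G> x y = {}")
  case True
  then show ?thesis using q(1) by simp
next
  case False
  obtain d where d: "1 \<le> d" "card S - 1 \<le> d" "d \<le> k - 1"
    "card (split_traces \<F> \<G> x y) \<le> d * (k ^ (d - 1) * ((card V - d) choose (k - 1 - d)))"
    using card_split_traces_branching[OF \<open>finite V\<close> \<F> \<G> cross S \<open>x \<noteq> y\<close> False] by blast
  have "q \<le> real k" using q(2) d(1,3) by linarith
  have eq: "card V - 1 - (d - 1) = card V - d" "k - 2 - (d - 1) = k - 1 - d"
    using d(1) by auto
  have "real (card (split_traces \<F> \<G> x y)) \<le> real (d * (k ^ (d - 1) * ((card V - d) choose (k - 1 - d))))"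
    using d(4) by (simp only: of_nat_le_iff)
  also have "\<dots> = real d * real (k ^ (d - 1) * ((card V - 1 - (d - 1)) choose (k - 2 - (d - 1))))"
    unfolding eq by simp
  also have "\<dots> \<le> real d * (q ^ (d - 1) * real ((card V - 1) choose (k - 2)))"
    using q(1) d(1,3) \<open>k \<le> card V\<close> \<open>q \<le> real k\<close>
    by (intro mult_left_mono power_times_binomial_le[OF _ _ q(3)]) auto
  also have "\<dots> = real d * q ^ (d - 1) * real ((card V - 1) choose (k - 2))"
    by simp
  also have "\<dots> \<le> real i * q ^ (i - 1) * real ((card V - 1) choose (k - 2))"
    using q(1,2) i d(1,2) by (intro mult_right_mono index_times_power_decreasing) auto
  finally show ?thesis .
qed

lemma card_Un3_le: "card (A \<union> B \<union> C) \<le> card A + card B + card C"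
  using card_Un_le[of "A \<union> B" C] card_Un_le[of A B] by linarith

text \<open>Write \<open>A = F \<inter> G\<close>. If \<open>A\<close> lacks just one element of \<open>F\<close> and misses the cover \<open>T\<close>, then that element is in \<open>T\<close>, since
  \<open>F\<close> itself meets \<open>T\<close>.\<close>

lemma wedge_level_below_cases:
  assumes \<F>: "\<F> \<subseteq> nsets V k" and \<G>: "\<G> \<subseteq> nsets V k" and "k \<ge> 1"
    and T: "minimum_cover T \<F>" and S: "minimum_cover S \<G>"
    and A: "A \<in> wedge \<F> \<G>" "card A = k - 1" "A \<inter> T = {}" "A \<inter> S = {}"
  obtains x y where "x \<in> T" "y \<in> S" "x \<noteq> y" "A \<in> split_traces \<F> \<G> x y"
proof -
  obtain F G where FG: "F \<in> \<F>" "G \<in> \<G>" "A = F \<inter> G"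
    using A(1) by (auto simp: wedge_def)
  have fin: "finite F" "card F = k" "finite G" "card G = k"
    using FG \<F> \<G> by (auto simp: nsets_def)
  have "card (F - A) = 1" "card (G - A) = 1"
    using fin FG(3) A(2) \<open>k \<ge> 1\<close> by (auto simp: card_Diff_subset)
  then obtain x y where xy: "F - A = {x}" "G - A = {y}"
    by (auto simp: card_1_singleton_iff)
  have "A \<subseteq> F" "A \<subseteq> G" using FG(3) by auto
  with xy have F: "F = insert x A" "x \<notin> A" and G: "G = insert y A" "y \<notin> A"
    by blast+
  have "x \<noteq> y"
  proof
    assume "x = y"
    then have "x \<in> F \<inter> G" using F(1) G(1) by simp
    with F(2) FG(3) show False by simp
  qed
  show ?thesis
  proof (rule that)
    show "x \<in> T" using minimum_coverD(2)[OF T FG(1)] F A(3) by auto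
    show "y \<in> S" using minimum_coverD(2)[OF S FG(2)] G A(4) by auto
    show "x \<noteq> y" by fact
    show "A \<in> split_traces \<F> \<G> x y" using F G FG(1,2) by (simp add: split_traces_def)
  qed
qed

text \<open>A set of this level meets \<open>T\<close>, or meets \<open>S\<close>, or is a trace for one of the pairs in \<open>T \<times> S\<close>.\<close>

lemma card_wedge_level_below_le:
  fixes q :: real
  assumes "finite V" and \<F>: "\<F> \<subseteq> nsets V k" and \<G>: "\<G> \<subseteq> nsets V k" and "k \<ge> 1"
    and cross: "cross_intersecting \<F> \<G>"
    and T: "minimum_cover T \<F>" and S: "minimum_cover S \<G>"
    and q: "0 \<le> q" "q \<le> 1 / 2" "real k * real (k - 2) \<le> q * real (card V - 1)"
    and "k \<le> card V" and i: "1 \<le> i" "i \<le> max 1 (card S - 1)"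
  shows "real (card {A \<in> wedge \<F> \<G>. card A = k - 1}) \<le>
    (real (card T) + real (card S) + real (card T) * real (card S) * (real i * q ^ (i - 1)))
      * real ((card V - 1) choose (k - 2))"
proof -
  define D where "D = (card V - 1) choose (k - 2)"
  define M where "M a = {A \<in> nsets V (k - 1). {a} \<subseteq> A}" for a
  define Z where "Z xy = (if fst xy = snd xy then {} else split_traces \<F> \<G> (fst xy) (snd xy))" for xy
  have fin: "finite T" "finite S" "finite (T \<times> S)"
    using minimum_coverD T S by auto
  have finM: "finite (M a)" for a
    using \<open>finite V\<close> by (simp add: M_def finite_imp_finite_nsets)
  have finZ: "finite (Z xy)" for xy
    using finite_subset[OF split_traces_nsets[OF \<F>] finite_imp_finite_nsets[OF \<open>finite V\<close>]]
    by (simp add: Z_def)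
  have M: "card (M a) \<le> D" for a
    using card_nsets_containing_le[OF \<open>finite V\<close>, of "{a}" "k - 1"]
    by (simp add: M_def D_def numeral_2_eq_2)
  have Z: "real (card (Z xy)) \<le> real i * q ^ (i - 1) * real D" for xy
    using card_split_traces_le[OF \<open>finite V\<close> \<F> \<G> cross S _ q \<open>k \<le> card V\<close> i] q(1)
    by (auto simp: Z_def D_def)
  \<comment> \<open>The diagonal is excluded in \<open>Z\<close>: traces are intersecting only for distinct added elements.\<close>
  have "{A \<in> wedge \<F> \<G>. card A = k - 1} \<subseteq> (\<Union>a\<in>T. M a) \<union> (\<Union>a\<in>S. M a) \<union> (\<Union>xy\<in>T \<times> S. Z xy)"
  proof
    fix A assume "A \<in> {A \<in> wedge \<F> \<G>. card A = k - 1}"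
    then have A: "A \<in> wedge \<F> \<G>" "card A = k - 1" by auto
    then have nA: "A \<in> nsets V (k - 1)"
      using wedge_memberD[OF \<F>] by (auto simp: nsets_def)
    show "A \<in> (\<Union>a\<in>T. M a) \<union> (\<Union>a\<in>S. M a) \<union> (\<Union>xy\<in>T \<times> S. Z xy)"
    proof (cases "A \<inter> T = {} \<and> A \<inter> S = {}")
      case True
      then obtain x y where "x \<in> T" "y \<in> S" "x \<noteq> y" "A \<in> split_traces \<F> \<G> x y"
        using wedge_level_below_cases[OF \<F> \<G> \<open>k \<ge> 1\<close> T S A] by blast
      then have "A \<in> Z (x, y)" "(x, y) \<in> T \<times> S" by (auto simp: Z_def)
      then show ?thesis by blast
    next
      case False
      then show ?thesis using nA by (auto simp: M_def)
    qed
  qed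
  then have "card {A \<in> wedge \<F> \<G>. card A = k - 1}
      \<le> card ((\<Union>a\<in>T. M a) \<union> (\<Union>a\<in>S. M a) \<union> (\<Union>xy\<in>T \<times> S. Z xy))"
    using fin finM finZ by (intro card_mono) auto
  also have "\<dots> \<le> card (\<Union>a\<in>T. M a) + card (\<Union>a\<in>S. M a) + card (\<Union>xy\<in>T \<times> S. Z xy)"
    by (rule card_Un3_le)
  also have "\<dots> \<le> (\<Sum>a\<in>T. card (M a)) + (\<Sum>a\<in>S. card (M a)) + (\<Sum>xy\<in>T \<times> S. card (Z xy))"
    using fin by (intro add_mono card_UN_le)
  finally have "real (card {A \<in> wedge \<F> \<G>. card A = k - 1})
      \<le> (\<Sum>a\<in>T. real (card (M a))) + (\<Sum>a\<in>S. real (card (M a))) + (\<Sum>xy\<in>T \<times> S. real (card (Z xy)))"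
    by (simp only: of_nat_sum[symmetric] of_nat_add[symmetric] of_nat_le_iff)
  also have "\<dots> \<le> (\<Sum>a\<in>T. real D) + (\<Sum>a\<in>S. real D) + (\<Sum>xy\<in>T \<times> S. real i * q ^ (i - 1) * real D)"
    using M Z by (intro add_mono sum_mono) auto
  also have "\<dots> = (real (card T) + real (card S) + real (card T) * real (card S) * (real i * q ^ (i - 1))) * real D"
    using fin by (simp add: card_cartesian_product algebra_simps)
  finally show ?thesis unfolding D_def .
qed

section \<open>Families without a common element\<close>

lemma card_wedge_small_le:
  assumes "finite V" "\<F> \<subseteq> nsets V k"
  shows "card {A \<in> wedge \<F> \<G>. card A \<le> m} \<le> (\<Sum>i\<le>m. card V choose i)"
proof -
  have "{A \<in> wedge \<F> \<G>. card A \<le> m} \<subseteq> (\<Union>i\<in>{..m}. nsets V i)"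
    using assms(2) by (auto simp: wedge_def nsets_def)
  then have "card {A \<in> wedge \<F> \<G>. card A \<le> m} \<le> card (\<Union>i\<in>{..m}. nsets V i)"
    using assms(1) by (intro card_mono) (auto simp: finite_imp_finite_nsets)
  also have "\<dots> \<le> (\<Sum>i\<in>{..m}. card (nsets V i))"
    by (rule card_UN_le) simp
  finally show ?thesis by simp
qed

text \<open>All levels are measured in multiples of \<open>D = (n - 1) choose (k - 2)\<close>. The top term of the target
  sum exceeds \<open>(2 * k + 9) * D\<close>. The levels \<open>k\<close> and \<open>k - 1\<close> use at most \<open>(2 * k + 8) * D\<close>, and the
  excess of the lower levels, where all subsets of the ground set are counted, uses at most
  one more \<open>D\<close>. The order \<open>card T \<le> card S\<close> makes \<open>card S\<close> the branching depth and lets it replace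
  \<open>card T\<close> as a factor.\<close>

lemma card_wedge_less_if_covers:
  assumes "finite V" and \<F>: "\<F> \<subseteq> nsets V k" and \<G>: "\<G> \<subseteq> nsets V k"
    and cross: "cross_intersecting \<F> \<G>" and "2 \<le> k" and n: "2 * k ^ 2 + 8 * k \<le> card V"
    and nonempty: "\<F> \<noteq> {}" "\<G> \<noteq> {}" and no_common: "\<And>x. \<exists>E\<in>\<F> \<union> \<G>. x \<notin> E"
    and T: "minimum_cover T \<F>" and S: "minimum_cover S \<G>" and "card T \<le> card S"
  shows "card (wedge \<F> \<G>) < (\<Sum>i = 0..k - 1. (card V - 1) choose i)"
proof -
  define n where "n = card V"
  define t where "t = card T"
  define s where "s = card S"
  define D where "D = (n - 1) choose (k - 2)"
  define q where "q = (real k - 1) / (2 * real k + 8)"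
  obtain j where j: "k = j + 2" using \<open>2 \<le> k\<close> by (metis le_add_diff_inverse2)
  have n': "2 * k ^ 2 + 8 * k \<le> n" using n by (simp add: n_def)
  obtain m where m: "n = 2 * k ^ 2 + 8 * k + m" using n' by (metis le_add_diff_inverse)
  have "k \<le> n" using n' by simp
  have "card V \<ge> k" "real (card V - 1) = real n - 1" "real (card V - 2) = real n - 2"
    using n' \<open>2 \<le> k\<close> by (auto simp: n_def)
  have q0: "0 \<le> q" and q2: "q \<le> 1 / 2"
    using \<open>2 \<le> k\<close> by (auto simp: q_def divide_simps)
  \<comment> \<open>The ratio \<open>k * (k - 2) / (card V - 2)\<close>, the loss per branching step, is at most \<open>q\<close> because
    \<open>card V\<close> is at least \<open>k * (2 * k + 8)\<close>.\<close>
  have "real k * real (k - 2) * (2 * real k + 8) \<le> (real k - 1) * (real n - 2)"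
    by (simp add: m j algebra_simps power2_eq_square)
  then have qn2: "real k * real (k - 2) \<le> q * real (card V - 2)"
    unfolding \<open>real (card V - 2) = real n - 2\<close> q_def times_divide_eq_left
    by (subst pos_le_divide_eq) simp_all
  also have "\<dots> \<le> q * real (card V - 1)"
    using q0 by (intro mult_left_mono) auto
  finally have qn1: "real k * real (k - 2) \<le> q * real (card V - 1)" .
  have "1 \<le> t" "1 \<le> s"
    using minimum_coverD[OF T] minimum_coverD[OF S] nonempty
    by (auto simp: t_def s_def Suc_le_eq card_gt_0_iff)
  have "s \<le> k"
  proof -
    obtain F where "F \<in> \<F>" using nonempty by auto
    then show ?thesis
      using cross_member_covers[OF cross \<F>] S by (auto simp: s_def minimum_cover_def)
  qed
  have "D > 0" using \<open>k \<le> n\<close> by (auto simp: D_def)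
  \<comment> \<open>The budget: the top term of the target sum, measured in multiples of \<open>D\<close>.\<close>
  have gap: "(2 * real k + 9) * real D < real ((n - 1) choose (k - 1))"
  proof -
    have "(k - 1) * ((n - 1) choose (k - 1)) = (n - 1 - (k - 2)) * D"
      using binomial_absorption[of "k - 2" "n - 1"] binomial_absorb_comp[of "n - 1" "k - 2"]
      by (simp add: D_def j)
    then have "real (k - 1) * real ((n - 1) choose (k - 1)) = real (n - 1 - (k - 2)) * real D"
      by (simp only: of_nat_mult[symmetric])
    then have "(real k - 1) * real ((n - 1) choose (k - 1)) = (real n - real k + 1) * real D"
      using \<open>k \<le> n\<close> \<open>2 \<le> k\<close> by (simp add: of_nat_diff)
    moreover have "(real k - 1) * (2 * real k + 9) < real n - real k + 1"
      by (simp add: m j algebra_simps power2_eq_square)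
    ultimately have "(real k - 1) * ((2 * real k + 9) * real D)
        < (real k - 1) * real ((n - 1) choose (k - 1))"
      using \<open>D > 0\<close> by (simp add: mult.assoc[symmetric])
    then show ?thesis using \<open>2 \<le> k\<close> by simp
  qed
  have levels: "real (card {A \<in> wedge \<F> \<G>. card A = k - 1}) + real (card {A \<in> wedge \<F> \<G>. card A = k})
      \<le> (2 * real k + 8) * real D"
  proof (cases "2 \<le> s")
    case True
    have "real (card {A \<in> wedge \<F> \<G>. card A = k - 1}) \<le>
        (real t + real s + real t * real s * (real (s - 1) * q ^ (s - 1 - 1))) * real D"
      unfolding t_def s_def D_def n_def
      using True \<open>2 \<le> k\<close> \<open>card V \<ge> k\<close>
      by (intro card_wedge_level_below_le[OF \<open>finite V\<close> \<F> \<G> _ cross T S q0 q2 qn1]) (auto simp: s_def)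
    also have "\<dots> \<le> (real s + real s + real s * real s * ((real s - 1) * q ^ (s - 2))) * real D"
      using True \<open>card T \<le> card S\<close> q0
      by (intro mult_right_mono add_mono mult_mono) (auto simp: s_def t_def numeral_2_eq_2)
    finally have below: "real (card {A \<in> wedge \<F> \<G>. card A = k - 1}) \<le>
        (real s + real s + real s * real s * ((real s - 1) * q ^ (s - 2))) * real D" .
    have "real (card {A \<in> wedge \<F> \<G>. card A = k}) \<le> real t * real k * q ^ (s - 2) * real D"
      unfolding t_def s_def D_def n_def
      using True \<open>s \<le> k\<close> \<open>card V \<ge> k\<close>
      by (intro card_wedge_level_top_le[OF \<open>finite V\<close> \<F> \<G> cross T S _ _ _ q0 q2 qn2]) (auto simp: s_def)
    also have "\<dots> \<le> real s * real k * q ^ (s - 2) * real D"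
      using \<open>card T \<le> card S\<close> q0 by (intro mult_right_mono) (auto simp: s_def t_def)
    finally have "real (card {A \<in> wedge \<F> \<G>. card A = k}) \<le> real s * real k * q ^ (s - 2) * real D" .
    with below have "real (card {A \<in> wedge \<F> \<G>. card A = k - 1}) + real (card {A \<in> wedge \<F> \<G>. card A = k})
        \<le> (2 * real s + real s * q ^ (s - 2) * (real s * (real s - 1) + real k)) * real D"
      by (simp add: algebra_simps)
    also have "\<dots> \<le> (2 * real k + 8) * real D"
      using cover_number_inequality[OF True \<open>s \<le> k\<close>] by (intro mult_right_mono) (auto simp: q_def)
    finally show ?thesis .
  next
    case False
    then have "s = 1" "t = 1"
      using \<open>1 \<le> s\<close> \<open>1 \<le> t\<close> \<open>card T \<le> card S\<close> by (auto simp: s_def t_def)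
    then obtain a b where ab: "T = {a}" "S = {b}"
      by (auto simp: s_def t_def card_1_singleton_iff)
    have aF: "a \<in> F" if "F \<in> \<F>" for F using minimum_coverD(2)[OF T that] ab by simp
    have bG: "b \<in> G" if "G \<in> \<G>" for G using minimum_coverD(2)[OF S that] ab by simp
    have "a \<noteq> b" using aF bG no_common[of a] by auto
    have "card {A \<in> wedge \<F> \<G>. card A = k} \<le> D"
      using card_wedge_level_top_le_common_elements[OF \<open>finite V\<close> \<F> \<G> \<open>a \<noteq> b\<close> aF bG]
      by (simp add: D_def n_def)
    moreover have "real (card {A \<in> wedge \<F> \<G>. card A = k - 1}) \<le>
        (real t + real s + real t * real s * (real 1 * q ^ (1 - 1))) * real D"
      unfolding t_def s_def D_def n_def
      using \<open>2 \<le> k\<close> \<open>card V \<ge> k\<close>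
      by (intro card_wedge_level_below_le[OF \<open>finite V\<close> \<F> \<G> _ cross T S q0 q2 qn1]) auto
    moreover have "4 * real D \<le> (2 * real k + 8) * real D"
      by (intro mult_right_mono) auto
    ultimately show ?thesis using \<open>s = 1\<close> \<open>t = 1\<close> by simp
  qed
  \<comment> \<open>The levels below contribute their share of the target sum and a surplus of at most one \<open>D\<close>.\<close>
  have small: "card {A \<in> wedge \<F> \<G>. card A \<le> k - 2} \<le> (\<Sum>i\<le>k - 2. (n - 1) choose i) + D"
  proof -
    have "card {A \<in> wedge \<F> \<G>. card A \<le> k - 2} \<le> (\<Sum>i\<le>k - 2. Suc (n - 1) choose i)"
      using card_wedge_small_le[OF \<open>finite V\<close> \<F>] \<open>k \<le> n\<close> \<open>2 \<le> k\<close> by (simp add: n_def)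
    also have "\<dots> = (\<Sum>i\<le>k - 2. (n - 1) choose i) + (\<Sum>i<k - 2. (n - 1) choose i)"
      by (rule sum_binomial_Suc)
    also have "\<dots> \<le> (\<Sum>i\<le>k - 2. (n - 1) choose i) + D"
      unfolding D_def using n' by (intro add_left_mono sum_binomial_below_le) simp
    finally show ?thesis .
  qed
  have "wedge \<F> \<G> \<subseteq> {A \<in> wedge \<F> \<G>. card A \<le> k - 2} \<union> {A \<in> wedge \<F> \<G>. card A = k - 1}
      \<union> {A \<in> wedge \<F> \<G>. card A = k}" (is "_ \<subseteq> ?U")
  proof
    fix A assume A: "A \<in> wedge \<F> \<G>"
    have "card A \<le> k" by (rule wedge_memberD(3)[OF \<F> A])
    then show "A \<in> ?U" using A by auto
  qed
  moreover have "finite (wedge \<F> \<G>)"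
  proof (rule finite_subset)
    show "wedge \<F> \<G> \<subseteq> Pow V" using wedge_memberD(1)[OF \<F>] by blast
    show "finite (Pow V)" using \<open>finite V\<close> by simp
  qed
  ultimately have "card (wedge \<F> \<G>) \<le> card ?U"
    by (intro card_mono) auto
  also have "\<dots> \<le> card {A \<in> wedge \<F> \<G>. card A \<le> k - 2} + card {A \<in> wedge \<F> \<G>. card A = k - 1}
      + card {A \<in> wedge \<F> \<G>. card A = k}"
    by (rule card_Un3_le)
  finally have "real (card (wedge \<F> \<G>)) \<le> real (\<Sum>i\<le>k - 2. (n - 1) choose i) + real D + (2 * real k + 8) * real D"
    using small levels by linarith
  also have "\<dots> < real (\<Sum>i\<le>k - 2. (n - 1) choose i) + real ((n - 1) choose (k - 1))"
    using gap by (simp add: algebra_simps)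
  also have "\<dots> = real (\<Sum>i = 0..k - 1. (n - 1) choose i)"
    by (simp add: j atMost_atLeast0)
  finally show ?thesis by (simp only: n_def of_nat_less_iff)
qed

lemma card_wedge_less_if_no_common_element:
  assumes "finite V" and \<F>: "\<F> \<subseteq> nsets V k" and \<G>: "\<G> \<subseteq> nsets V k"
    and cross: "cross_intersecting \<F> \<G>" and "1 \<le> k" and n: "2 * k ^ 2 + 8 * k \<le> card V"
    and no_common: "\<And>x. \<exists>E\<in>\<F> \<union> \<G>. x \<notin> E"
  shows "card (wedge \<F> \<G>) < (\<Sum>i = 0..k - 1. (card V - 1) choose i)"
proof (cases "\<F> = {} \<or> \<G> = {}")
  case True
  then have "wedge \<F> \<G> = {}" by (auto simp: wedge_def)
  moreover have "0 < (\<Sum>i = 0..k - 1. (card V - 1) choose i)"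
    by (rule sum_pos2[of _ 0]) auto
  ultimately show ?thesis by simp
next
  case False
  then obtain F G where FG: "F \<in> \<F>" "G \<in> \<G>" by auto
  have cross': "cross_intersecting \<G> \<F>" using cross by (rule cross_intersecting_sym)
  \<comment> \<open>Cross-intersecting families of singletons consist of one and the same singleton.\<close>
  have "k \<noteq> 1"
  proof
    assume "k = 1"
    have sing: "\<exists>z. E = {z}" if "E \<in> \<F> \<union> \<G>" for E
      using that \<F> \<G> by (auto simp: nsets_def \<open>k = 1\<close> card_1_singleton_iff)
    obtain x where x: "F = {x}" using sing FG by blast
    have Gx: "E = {x}" if "E \<in> \<G>" for E
      using sing[of E] cross_intersectingD[OF cross FG(1) that] that x by auto
    have "E = {x}" if "E \<in> \<F>" for E
      using sing[of E] cross_intersectingD[OF cross that FG(2)] that Gx[OF FG(2)] by auto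
    with Gx no_common[of x] show False by auto
  qed
  then have "2 \<le> k" using \<open>1 \<le> k\<close> by simp
  obtain T where T: "minimum_cover T \<F>"
    using minimum_cover_exists[OF cross_member_covers(1)[OF cross' \<G> FG(2)]] by blast
  obtain S where S: "minimum_cover S \<G>"
    using minimum_cover_exists[OF cross_member_covers(1)[OF cross \<F> FG(1)]] by blast
  show ?thesis
  proof (cases "card T \<le> card S")
    case True
    then show ?thesis
      using card_wedge_less_if_covers[OF \<open>finite V\<close> \<F> \<G> cross \<open>2 \<le> k\<close> n _ _ no_common T S] False
      by blast
  next
    case False
    have "\<exists>E\<in>\<G> \<union> \<F>. x \<notin> E" for x using no_common by blast
    then show ?thesis
      using card_wedge_less_if_covers[OF \<open>finite V\<close> \<G> \<F> cross' \<open>2 \<le> k\<close> n _ _ _ S T] False FG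
      by (auto simp: wedge_commute[of \<F>])
  qed
qed

section \<open>Families with a common element\<close>

lemma card_bounded_sets_containing:
  assumes "finite V" "x \<in> V" "1 \<le> k"
  shows "card {A. A \<subseteq> V \<and> x \<in> A \<and> card A \<le> k} = (\<Sum>i = 0..k - 1. (card V - 1) choose i)"
proof -
  let ?B = "\<Union>i\<in>{0..k - 1}. nsets (V - {x}) i"
  have "insert x ` ?B = {A. A \<subseteq> V \<and> x \<in> A \<and> card A \<le> k}"
  proof (intro equalityI subsetI)
    fix A assume "A \<in> insert x ` ?B"
    then show "A \<in> {A. A \<subseteq> V \<and> x \<in> A \<and> card A \<le> k}"
      using assms by (auto simp: nsets_def card_insert_if)
  next
    fix A assume A: "A \<in> {A. A \<subseteq> V \<and> x \<in> A \<and> card A \<le> k}"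
    then have "finite A" using \<open>finite V\<close> finite_subset by auto
    then have "A - {x} \<in> ?B" using A by (auto simp: nsets_def)
    moreover have "A = insert x (A - {x})" using A by auto
    ultimately show "A \<in> insert x ` ?B" by blast
  qed
  moreover have "inj_on (insert x) ?B"
    by (rule inj_onI) (auto simp: nsets_def insert_ident)
  ultimately have "card {A. A \<subseteq> V \<and> x \<in> A \<and> card A \<le> k} = card ?B"
    by (metis card_image)
  also have "\<dots> = (\<Sum>i = 0..k - 1. card (nsets (V - {x}) i))"
    using \<open>finite V\<close> by (intro card_UN_disjoint) (auto simp: finite_imp_finite_nsets nsets_def)
  finally show ?thesis using assms by simp
qed

text \<open>The star produces every set of size at most \<open>k\<close> through \<open>x\<close>, which is why it attains the bound.\<close>

lemma wedge_star:
  assumes "finite V" "2 * k \<le> card V"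
  shows "wedge {S \<in> nsets V k. x \<in> S} {S \<in> nsets V k. x \<in> S} = {A. A \<subseteq> V \<and> x \<in> A \<and> card A \<le> k}"
proof (intro equalityI subsetI)
  fix A assume "A \<in> wedge {S \<in> nsets V k. x \<in> S} {S \<in> nsets V k. x \<in> S}"
  then obtain F G where "F \<in> nsets V k" "x \<in> F" "x \<in> G" "A = F \<inter> G"
    by (auto simp: wedge_def)
  moreover from this have "card A \<le> card F"
    by (intro card_mono) (auto simp: nsets_def)
  ultimately show "A \<in> {A. A \<subseteq> V \<and> x \<in> A \<and> card A \<le> k}"
    by (auto simp: nsets_def)
next
  fix A assume "A \<in> {A. A \<subseteq> V \<and> x \<in> A \<and> card A \<le> k}"
  then have A: "A \<subseteq> V" "x \<in> A" "card A \<le> k" "finite A"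
    using \<open>finite V\<close> finite_subset by auto
  have cV: "card (V - A) = card V - card A"
    using A by (simp add: card_Diff_subset)
  \<comment> \<open>Extend \<open>A\<close> in two disjoint ways; there is room because \<open>2 * k \<le> card V\<close>.\<close>
  have "k - card A \<le> card (V - A)" using cV A(3) assms(2) by linarith
  then obtain B where B: "B \<subseteq> V - A" "card B = k - card A" "finite B"
    using obtain_subset_with_card_n by metis
  have "card (V - A - B) = card V - card A - (k - card A)"
    using B cV by (simp add: card_Diff_subset)
  then have "k - card A \<le> card (V - A - B)" using A(3) assms(2) by linarith
  then obtain C where C: "C \<subseteq> V - A - B" "card C = k - card A" "finite C"
    using obtain_subset_with_card_n by metis
  have "card (A \<union> B) = k" "card (A \<union> C) = k"
    using A B C card_Un_disjoint[of A B] card_Un_disjoint[of A C] by auto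
  then have "A \<union> B \<in> {S \<in> nsets V k. x \<in> S}" "A \<union> C \<in> {S \<in> nsets V k. x \<in> S}"
    using A B C by (auto simp: nsets_def)
  moreover have "A = (A \<union> B) \<inter> (A \<union> C)" using B C by auto
  ultimately show "A \<in> wedge {S \<in> nsets V k. x \<in> S} {S \<in> nsets V k. x \<in> S}"
    unfolding wedge_def by blast
qed

lemma wedge_subset_if_common_element:
  assumes \<F>: "\<F> \<subseteq> nsets V k" and common: "\<And>E. E \<in> \<F> \<union> \<G> \<Longrightarrow> x \<in> E"
  shows "wedge \<F> \<G> \<subseteq> {A. A \<subseteq> V \<and> x \<in> A \<and> card A \<le> k}"
proof
  fix A assume A: "A \<in> wedge \<F> \<G>"
  then have "x \<in> A" using common by (auto simp: wedge_def)
  then show "A \<in> {A. A \<subseteq> V \<and> x \<in> A \<and> card A \<le> k}"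
    using wedge_memberD[OF \<F> A] by simp
qed

text \<open>Already the \<open>k\<close>-element members of the full wedge force both families to contain the whole star.\<close>

lemma stars_if_wedge_full:
  assumes \<F>: "\<F> \<subseteq> nsets V k" and \<G>: "\<G> \<subseteq> nsets V k"
    and common: "\<And>E. E \<in> \<F> \<union> \<G> \<Longrightarrow> x \<in> E"
    and full: "wedge \<F> \<G> = {A. A \<subseteq> V \<and> x \<in> A \<and> card A \<le> k}"
  shows "\<F> = {S \<in> nsets V k. x \<in> S}" "\<G> = {S \<in> nsets V k. x \<in> S}"
proof -
  have "S \<in> \<F> \<inter> \<G>" if "S \<in> nsets V k" "x \<in> S" for S
    using wedge_level_top[OF \<F> \<G>] full that by (auto simp: nsets_def)
  then show "\<F> = {S \<in> nsets V k. x \<in> S}" "\<G> = {S \<in> nsets V k. x \<in> S}"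
    using \<F> \<G> common by blast+
qed

lemma permutes_image_full_star:
  assumes "\<sigma> permutes {1..n}"
  shows "(\<lambda>S. \<sigma> ` S) ` full_star n k y = full_star n k (\<sigma> y)"
proof -
  have sub: "(\<lambda>S. \<pi> ` S) ` full_star n k z \<subseteq> full_star n k (\<pi> z)" if \<pi>: "\<pi> permutes {1..n}" for \<pi> z
  proof -
    have "card (\<pi> ` S) = card S" for S
      using permutes_inj_on[OF \<pi>] by (rule card_image)
    then show ?thesis
      using permutes_image[OF \<pi>] by (auto simp: full_star_def nsets_def)
  qed
  have "S \<in> (\<lambda>S. \<sigma> ` S) ` full_star n k y" if "S \<in> full_star n k (\<sigma> y)" for S
  proof
    show "S = \<sigma> ` (inv \<sigma> ` S)"
      using permutes_surj[OF assms] by (simp add: image_comp surj_iff)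
    show "inv \<sigma> ` S \<in> full_star n k y"
      using sub[OF permutes_inv[OF assms], of "\<sigma> y"] that permutes_inverses(2)[OF assms] by auto
  qed
  with sub[OF assms] show ?thesis by blast
qed

text \<open>Permutations carry stars to stars, so being isomorphic to the star of 1 means being the star of some
  point of the ground set.\<close>

lemma isomorphic_full_stars_iff:
  assumes "n > 0"
  shows "isomorphic_pairs n (\<F>, \<G>) (full_star n k 1, full_star n k 1) \<longleftrightarrow>
    (\<exists>x\<in>{1..n}. \<F> = full_star n k x \<and> \<G> = full_star n k x)"
proof
  assume "isomorphic_pairs n (\<F>, \<G>) (full_star n k 1, full_star n k 1)"
  then obtain \<pi> where \<pi>: "\<pi> permutes {1..n}"
    and im: "(\<lambda>S. \<pi> ` S) ` \<F> = full_star n k 1" "(\<lambda>S. \<pi> ` S) ` \<G> = full_star n k 1"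
    by (auto simp: isomorphic_pairs_def)
  have "inv \<pi> 1 \<in> {1..n}"
    using permutes_in_image[OF permutes_inv[OF \<pi>], of 1] assms by simp
  moreover have "\<H> = full_star n k (inv \<pi> 1)" if "(\<lambda>S. \<pi> ` S) ` \<H> = full_star n k 1" for \<H>
  proof -
    have "(\<lambda>S. inv \<pi> ` S) ` (\<lambda>S. \<pi> ` S) ` \<H> = \<H>"
      using permutes_inv_o(2)[OF \<pi>] by (simp add: image_comp image_image)
    then show ?thesis
      using permutes_image_full_star[OF permutes_inv[OF \<pi>], of k 1] that by simp
  qed
  ultimately show "\<exists>x\<in>{1..n}. \<F> = full_star n k x \<and> \<G> = full_star n k x"
    using im by blast
next
  assume "\<exists>x\<in>{1..n}. \<F> = full_star n k x \<and> \<G> = full_star n k x"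
  then obtain x where x: "x \<in> {1..n}" "\<F> = full_star n k x" "\<G> = full_star n k x"
    by blast
  have "transpose x 1 permutes {1..n}"
    using x(1) assms by (intro permutes_swap_id) auto
  then show "isomorphic_pairs n (\<F>, \<G>) (full_star n k 1, full_star n k 1)"
    using permutes_image_full_star[of "transpose x 1" n k x] x by (auto simp: isomorphic_pairs_def)
qed

section \<open>The maximum size of a wedge\<close>

theorem theorem1p3:
  fixes n k :: nat and \<F> \<G> :: "nat set set"
  assumes "n > 0" and "k > 0"
    and "n \<ge> 2 * k ^ 2 + 8 * k"
    and "\<F> \<subseteq> nsets {1..n} k" and "\<G> \<subseteq> nsets {1..n} k"
    and "cross_intersecting \<F> \<G>"
  shows "card (wedge \<F> \<G>) \<le> (\<Sum>i = 0..k - 1. (n - 1) choose i) \<and>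
    (card (wedge \<F> \<G>) = (\<Sum>i = 0..k - 1. (n - 1) choose i) \<longleftrightarrow>
      isomorphic_pairs n (\<F>, \<G>) (full_star n k 1, full_star n k 1))"
proof -
  let ?V = "{1..n}" and ?N = "\<Sum>i = 0..k - 1. (n - 1) choose i"
  let ?U = "\<lambda>x. {A. A \<subseteq> ?V \<and> x \<in> A \<and> card A \<le> k}"
  have star: "card (wedge (full_star n k x) (full_star n k x)) = ?N" if "x \<in> ?V" for x
    using wedge_star[of ?V k x] card_bounded_sets_containing[of ?V x k] assms(2,3) that
    by (simp add: full_star_def)
  have "card (wedge \<F> \<G>) \<le> ?N \<and>
    (card (wedge \<F> \<G>) = ?N \<longrightarrow> (\<exists>x\<in>?V. \<F> = full_star n k x \<and> \<G> = full_star n k x))"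
  proof (cases "\<exists>x. \<forall>E\<in>\<F> \<union> \<G>. x \<in> E")
    case False
    then have "card (wedge \<F> \<G>) < ?N"
      using card_wedge_less_if_no_common_element[of ?V \<F> k \<G>] assms by auto
    then show ?thesis by simp
  next
    case True
    then obtain x where x: "\<And>E. E \<in> \<F> \<union> \<G> \<Longrightarrow> x \<in> E" by blast
    show ?thesis
    proof (cases "x \<in> ?V")
      case True
      have sub: "wedge \<F> \<G> \<subseteq> ?U x"
        by (rule wedge_subset_if_common_element[OF assms(4) x])
      have card_U: "card (?U x) = ?N"
        using card_bounded_sets_containing[of ?V x k] True assms(2) by simp
      have "card (wedge \<F> \<G>) \<le> ?N"
        using card_mono[OF _ sub] card_U by simp
      moreover have "\<F> = full_star n k x \<and> \<G> = full_star n k x" if "card (wedge \<F> \<G>) = ?N"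
      proof -
        have "wedge \<F> \<G> = ?U x"
          using card_subset_eq[OF _ sub] card_U that by simp
        then show ?thesis
          using stars_if_wedge_full[OF assms(4,5) x] by (simp add: full_star_def)
      qed
      ultimately show ?thesis using True by blast
    next
      \<comment> \<open>A point outside the ground set can be common to all members only of empty families.\<close>
      case False
      then have "\<F> = {}" using x assms(4) by (fastforce simp: nsets_def)
      then have "wedge \<F> \<G> = {}" by (simp add: wedge_def)
      moreover have "0 < ?N" by (rule sum_pos2[of _ 0]) auto
      ultimately have "card (wedge \<F> \<G>) < ?N" by (simp only: card.empty)
      then show ?thesis by linarith
    qed
  qed
  then show ?thesis
    using star isomorphic_full_stars_iff[OF assms(1), of \<F> \<G> k] by auto
qed

end
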